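(* For every integer $r\geq 3$, $f_r(n,r+1,r)\leq e^{(\log n)^{2/5+o(1)}}=n^{o(1)}$ as $n\to\infty$.
   Context: For positive integers $p,q,r,n\geq 2$ with $q\leq\binom{p}{r}$, an edge-colouring of the complete $r$-uniform hypergraph $K_n^{(r)}$ is a $(p,q)$-colouring if among the edges spanned by any $p$ vertices at least $q$ distinct colours appear. $f_r(n,p,q)$ is the smallest positive integer $k$ such that there is a colouring of the edges of $K_n^{(r)}$ with $k$ colours which is a $(p,q)$-colouring. *)

theory Defs
  imports Complex_Main "HOL-Library.Ramsey" "HOL-Library.FuncSet"
begin

(* The complete r-uniform hypergraph on V has edge set nsets V r. A colouring is a
   function on all sets, of which only the values on the edges matter. *)
definition pq_colouring ::
    "nat \<Rightarrow> 'a set \<Rightarrow> nat \<Rightarrow> nat \<Rightarrow> ('a set \<Rightarrow> 'b) \<Rightarrow> bool" where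
  "pq_colouring r V p q c \<longleftrightarrow> (\<forall>S \<in> nsets V p. q \<le> card (c ` nsets S r))"

(* This is f_r(n,p,q). The palette is {..<k}. Not every colour has to be used, which does not affect the
   minimum once n \<ge> r. For p, q, r, n \<ge> 2 and q \<le> p choose r an admissible k exists, since all edges
   can be given distinct colours. *)
definition erdos_gyarfas :: "nat \<Rightarrow> nat \<Rightarrow> nat \<Rightarrow> nat \<Rightarrow> nat" where
  "erdos_gyarfas r n p q = (LEAST k. 0 < k \<and>
     (\<exists>c. c \<in> nsets {..<n} r \<rightarrow> {..<k} \<and> pq_colouring r {..<n} p q c))"

end

theory Submission
  imports Defs
begin

text \<open>
  Number the vertices by the leaves of a binary tree. A triple x < y < z splits at its top branching
  either as x | yz or as xy | z, and is coloured as the row edge (x, yz) or the column edge (xy, z) of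
  a grid without alternating rectangles; an r-set is coloured by the colours of its ordered triples
  together with the heights at which its pairs split. Of an (r + 1)-set, two r-subsets can then only
  share a colour if the omitted vertices are siblings, and two such coincidences, with siblings
  a, a' and b, b', would give an alternating rectangle.

  For the grid, colour row a by a code word phi a composed with an edge colouring of the complete graph
  on the columns, such that different code words agree on few colours. Then columns can be
  coloured between rows a and a' provided that a union of few colour classes has small chromatic
  number. Such an edge colouring is obtained by taking the columns to be sequences of blocks, each a
  vector over a large alphabet, and recording a coordinate where two columns differ, the two values
  there, and the set of all differing coordinates of the same block. With exp L colours this handles
  unions of L^(3/2) colour classes and, up to logarithmic factors in the exponent, exp (L^(5/2)) rows
  and columns.
\<close>

section \<open>Chromatic numbers of relations\<close>

text \<open>The chromatic number of the graph \<open>R\<close>, with the whole type as vertex set,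
  is at most \<open>K\<close>. Total colourings can be pulled back and combined without tracking a
  vertex set.\<close>

definition colourable :: "('v \<Rightarrow> 'v \<Rightarrow> bool) \<Rightarrow> nat \<Rightarrow> bool" where
  "colourable R K \<longleftrightarrow> (\<exists>f :: 'v \<Rightarrow> nat. (\<forall>x. f x < K) \<and> (\<forall>x y. R x y \<longrightarrow> f x \<noteq> f y))"

lemma colourableI:
  fixes f :: "'v \<Rightarrow> 'c"
  assumes "finite F" "card F \<le> K" "\<And>x. f x \<in> F" "\<And>x y. R x y \<Longrightarrow> f x \<noteq> f y"
  shows "colourable R K"
proof -
  obtain h where h: "bij_betw h F {0..<card F}"
    using ex_bij_betw_finite_nat[OF assms(1)] by blast
  have "h (f x) < K" for x
    using bij_betwE[OF h] assms(2) assms(3)[of x] by fastforce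
  moreover have "h (f x) \<noteq> h (f y)" if "R x y" for x y
    using inj_onD[OF bij_betw_imp_inj_on[OF h], of "f x" "f y"] assms(3,4) that by blast
  ultimately show ?thesis
    unfolding colourable_def by (intro exI[of _ "\<lambda>x. h (f x)"]) auto
qed

lemma colourable_mono: "colourable R K \<Longrightarrow> K \<le> L \<Longrightarrow> colourable R L"
  unfolding colourable_def by (meson order_less_le_trans)

lemma colourable_subrel: "colourable R K \<Longrightarrow> (\<And>x y. Q x y \<Longrightarrow> R x y) \<Longrightarrow> colourable Q K"
  unfolding colourable_def by meson

lemma colourable_pullback:
  assumes "colourable R K" shows "colourable (\<lambda>x y. R (g x) (g y)) K"
proof -
  from assms obtain f :: "'a \<Rightarrow> nat" where "\<forall>x. f x < K" "\<forall>x y. R x y \<longrightarrow> f x \<noteq> f y"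
    unfolding colourable_def by blast
  then show ?thesis
    unfolding colourable_def by (intro exI[of _ "\<lambda>x. f (g x)"]) auto
qed

text \<open>The tuple of the individual colours is proper for the union of the edge sets, so the
  numbers of colours multiply.\<close>

lemma colourable_Bex:
  assumes "finite B" "\<And>b. b \<in> B \<Longrightarrow> colourable (R b) (K b)"
  shows "colourable (\<lambda>x y. \<exists>b\<in>B. R b x y) (\<Prod>b\<in>B. K b)"
proof -
  have "\<forall>b\<in>B. \<exists>f :: 'b \<Rightarrow> nat. (\<forall>x. f x < K b) \<and> (\<forall>x y. R b x y \<longrightarrow> f x \<noteq> f y)"
    using assms(2) unfolding colourable_def by blast
  then obtain f where f: "\<And>b x. b \<in> B \<Longrightarrow> f b x < K b"
    "\<And>b x y. b \<in> B \<Longrightarrow> R b x y \<Longrightarrow> (f b x :: nat) \<noteq> f b y"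
    by metis
  show ?thesis
  proof (rule colourableI[where F = "PiE B (\<lambda>b. {..<K b})" and f = "\<lambda>x. \<lambda>b\<in>B. f b x"])
    show "(\<lambda>b\<in>B. f b x) \<noteq> (\<lambda>b\<in>B. f b y)" if "\<exists>b\<in>B. R b x y" for x y
      using that f(2) by (metis restrict_apply')
  qed (use assms(1) f(1) in \<open>auto simp: card_PiE intro: finite_PiE\<close>)
qed

lemma colourable_disj:
  assumes "colourable R K" "colourable Q L"
  shows "colourable (\<lambda>x y. R x y \<or> Q x y) (K * L)"
proof -
  have "colourable (\<lambda>x y. \<exists>b\<in>UNIV. (if b then R else Q) x y) (\<Prod>b\<in>UNIV. if b then K else L)"
    using assms by (intro colourable_Bex) auto
  then show ?thesis
    by (simp add: UNIV_bool ex_bool_eq mult.commute disj_commute)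
qed

text \<open>Vertices are inserted one at a time; the at most \<open>d\<close> neighbours of the new
  vertex leave one of the \<open>d + 1\<close> colours \<open>{..d}\<close> free.\<close>

lemma greedy_colouring:
  assumes "finite V" "\<And>x y. R x y \<Longrightarrow> R y x" "\<And>x. \<not> R x x"
    and "\<And>x. x \<in> V \<Longrightarrow> card {y \<in> V. R x y} \<le> d"
  shows "\<exists>f :: 'v \<Rightarrow> nat. (\<forall>x. f x \<le> d) \<and> (\<forall>x\<in>V. \<forall>y\<in>V. R x y \<longrightarrow> f x \<noteq> f y)"
  using assms(1,4)
proof (induction V rule: finite_induct)
  case empty
  then show ?case by (intro exI[of _ "\<lambda>_. 0"]) auto
next
  case (insert v V)
  have "card {y \<in> V. R x y} \<le> d" if "x \<in> V" for x
  proof -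
    have "card {y \<in> V. R x y} \<le> card {y \<in> insert v V. R x y}"
      using insert.hyps(1) by (intro card_mono) auto
    then show ?thesis using insert.prems[of x] that by simp
  qed
  from insert.IH[OF this] obtain f :: "'v \<Rightarrow> nat" where
    f: "\<forall>x. f x \<le> d" "\<forall>x\<in>V. \<forall>y\<in>V. R x y \<longrightarrow> f x \<noteq> f y" by blast
  have "card (f ` {y \<in> V. R v y}) \<le> card {y \<in> V. R v y}"
    using insert.hyps(1) by (intro card_image_le) auto
  also have "\<dots> \<le> card {y \<in> insert v V. R v y}"
    using insert.hyps(1) by (intro card_mono) auto
  also have "\<dots> \<le> d" using insert.prems by auto
  also have "d < card {..d}" by simp
  finally have lt: "card (f ` {y \<in> V. R v y}) < card {..d}" .
  have "finite (f ` {y \<in> V. R v y})" using insert.hyps(1) by simp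
  with lt have "\<not> {..d} \<subseteq> f ` {y \<in> V. R v y}"
    using card_mono leD by blast
  then obtain a where a: "a \<le> d" "a \<notin> f ` {y \<in> V. R v y}" by auto
  show ?case
  proof (intro exI[of _ "f(v := a)"] conjI allI ballI impI)
    fix x y assume "x \<in> insert v V" "y \<in> insert v V" "R x y"
    then show "(f(v := a)) x \<noteq> (f(v := a)) y"
      using f(2) a(2) assms(2)[OF \<open>R x y\<close>] assms(3)[of v] by (auto simp: image_iff)
  qed (use f(1) a(1) in auto)
qed

section \<open>Unions of colour classes of the difference colouring\<close>

text \<open>The colour of a pair x, y is (i, {x i, y i}, v), where i is any coordinate in which x and y
  differ and v is the set of all such coordinates.\<close>

definition linked :: "('i \<times> 'a set \<times> 'i set) set \<Rightarrow> ('i \<Rightarrow> 'a) \<Rightarrow> ('i \<Rightarrow> 'a) \<Rightarrow> bool" where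
  "linked X x y \<longleftrightarrow> (\<exists>i. x i \<noteq> y i \<and> (i, {x i, y i}, {j. x j \<noteq> y j}) \<in> X)"

text \<open>A vector close to \<open>a\<close> is recovered from \<open>a\<close> and a list of
  \<open>u\<close> pairs (coordinate, new value), so there are no more such vectors than
  lists.\<close>

lemma card_hamming_ball:
  assumes "finite I" "finite W" "a \<in> I \<rightarrow>\<^sub>E W"
  shows "card {b \<in> I \<rightarrow>\<^sub>E W. a \<noteq> b \<and> card {i \<in> I. a i \<noteq> b i} \<le> u} \<le> (card I * card W) ^ u"
    (is "card ?B \<le> _")
proof -
  let ?L = "{xs. set xs \<subseteq> I \<times> W \<and> length xs = u}"
  let ?F = "\<lambda>xs i. case map_of xs i of Some c \<Rightarrow> c | None \<Rightarrow> a i"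
  have fin: "finite ?L" using assms by (intro finite_lists_length_eq) auto
  have "?B \<subseteq> ?F ` ?L"
  proof
    fix b assume b: "b \<in> ?B"
    let ?D = "{i \<in> I. a i \<noteq> b i}"
    have bW: "b \<in> I \<rightarrow>\<^sub>E W" and ne: "a \<noteq> b" and le: "card ?D \<le> u" using b by auto
    have "?D \<noteq> {}" using PiE_ext[OF assms(3) bW] ne by blast
    have "finite ?D" using assms(1) by auto
    then obtain l where l: "set l = ?D" "distinct l" using finite_distinct_list by blast
    have len: "length l = card ?D" using l distinct_card by metis
    have lne: "l \<noteq> []" using l(1) \<open>?D \<noteq> {}\<close> by fastforce
    \<comment> \<open>All lists must have length exactly \<open>u\<close>, so the list of changed
      coordinates is padded with copies of its head, which exists because
      \<open>a \<noteq> b\<close>.\<close>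
    define l' where "l' = l @ replicate (u - card ?D) (hd l)"
    have "set (replicate (u - card ?D) (hd l)) \<subseteq> set l"
      using hd_in_set[OF lne] by auto
    then have sl: "set l' = ?D" unfolding l'_def set_append using l(1) by blast
    define xs where "xs = map (\<lambda>i. (i, b i)) l'"
    have m: "map_of xs i = (if i \<in> ?D then Some (b i) else None)" for i
      unfolding xs_def map_of_map_restrict sl by (simp add: restrict_map_def)
    have "b i = ?F xs i" for i
    proof (cases "i \<in> I")
      case True
      then show ?thesis unfolding m by simp
    next
      case False
      then show ?thesis unfolding m using PiE_arb[OF assms(3)] PiE_arb[OF bW] by simp
    qed
    then have "b = ?F xs" by blast
    moreover have "set xs \<subseteq> I \<times> W"
      unfolding xs_def set_map sl using PiE_mem[OF bW] by blast
    moreover have "length xs = u" unfolding xs_def l'_def using len le by simp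
    ultimately show "b \<in> ?F ` ?L" by blast
  qed
  then have "card ?B \<le> card ?L" using fin by (meson card_image_le card_mono finite_imageI order_trans)
  also have "\<dots> = (card I * card W) ^ u"
    using assms by (subst card_lists_length_eq) (auto simp: card_cartesian_product)
  finally show ?thesis .
qed

text \<open>Values outside A are identified. Linked vectors then still differ at the coordinate of their
  colour, and in at most u of the coordinates I, so a greedy colouring applies.\<close>

lemma colourable_sparse:
  fixes X :: "('i \<times> 'a set \<times> 'i set) set"
  assumes I: "finite I" "card I \<le> s" "fst ` X \<subseteq> I"
    and A: "finite A" "card A \<le> 2 * s" "\<And>i P v. (i, P, v) \<in> X \<Longrightarrow> P \<subseteq> A"
    and v: "\<And>i P v. (i, P, v) \<in> X \<Longrightarrow> card (v \<inter> I) \<le> u"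
  shows "colourable (linked X) ((s * (2 * s + 1)) ^ u + 1)"
proof -
  define W where "W = insert None (Some ` A)"
  have W: "finite W" "card W \<le> 2 * s + 1"
    using A by (auto simp: W_def card_insert_if card_image)
  define R where "R a b \<longleftrightarrow> a \<noteq> b \<and> card {i \<in> I. a i \<noteq> b i} \<le> u"
    for a b :: "'i \<Rightarrow> 'a option"
  define g where "g x = (\<lambda>i\<in>I. if x i \<in> A then Some (x i) else None)" for x :: "'i \<Rightarrow> 'a"
  have g: "g x \<in> I \<rightarrow>\<^sub>E W" for x by (auto simp: g_def W_def)
  have "\<exists>f :: ('i \<Rightarrow> 'a option) \<Rightarrow> nat. (\<forall>a. f a \<le> (s * (2 * s + 1)) ^ u) \<and>
      (\<forall>a\<in>I \<rightarrow>\<^sub>E W. \<forall>b\<in>I \<rightarrow>\<^sub>E W. R a b \<longrightarrow> f a \<noteq> f b)"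
  proof (rule greedy_colouring)
    show "finite (I \<rightarrow>\<^sub>E W)" using I W by (intro finite_PiE) auto
    show "R b a" if "R a b" for a b using that by (simp add: R_def eq_commute)
    show "\<not> R a a" for a by (simp add: R_def)
    show "card {b \<in> I \<rightarrow>\<^sub>E W. R a b} \<le> (s * (2 * s + 1)) ^ u" if "a \<in> I \<rightarrow>\<^sub>E W" for a
      unfolding R_def using I(2) W(2)
      by (intro order_trans[OF card_hamming_ball[OF I(1) W(1) that]] power_mono mult_mono) auto
  qed
  then obtain f :: "('i \<Rightarrow> 'a option) \<Rightarrow> nat" where f: "\<And>a. f a \<le> (s * (2 * s + 1)) ^ u"
    "\<And>a b. a \<in> I \<rightarrow>\<^sub>E W \<Longrightarrow> b \<in> I \<rightarrow>\<^sub>E W \<Longrightarrow> R a b \<Longrightarrow> f a \<noteq> f b" by blast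
  have "R (g x) (g y)" if xy: "linked X x y" for x y
  proof -
    from xy obtain i where i: "x i \<noteq> y i" "(i, {x i, y i}, {j. x j \<noteq> y j}) \<in> X"
      unfolding linked_def by blast
    have "i \<in> I" "x i \<in> A" "y i \<in> A" using A(3)[OF i(2)] I(3) image_eqI[OF _ i(2), of i fst] by auto
    then have "g x i \<noteq> g y i" using i(1) by (simp add: g_def)
    \<comment> \<open>Identifying values may remove differences but never creates one.\<close>
    moreover have "card {i \<in> I. g x i \<noteq> g y i} \<le> card ({j. x j \<noteq> y j} \<inter> I)"
      using I(1) by (intro card_mono) (auto simp: g_def)
    ultimately show ?thesis using v[OF i(2)] unfolding R_def by auto
  qed
  then show ?thesis
    unfolding colourable_def using f g by (intro exI[of _ "\<lambda>x. f (g x)"]) (auto simp: less_Suc_eq_le)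
qed

lemma linked_empty [simp]: "\<not> linked {} x y"
  by (simp add: linked_def)

text \<open>Split the vectors by their value at p. If it is a fixed element of A, no colour with p in its
  difference set occurs; if it is outside A, no colour located at p occurs.\<close>

lemma colourable_branch:
  fixes X :: "('i \<times> 'a set \<times> 'i set) set"
  assumes A: "finite A" "card A \<le> q" "\<And>i P v. (i, P, v) \<in> X \<Longrightarrow> P \<subseteq> A"
    and "colourable (linked {c \<in> X. p \<notin> snd (snd c)}) K" "colourable (linked {c \<in> X. fst c \<noteq> p}) L"
  shows "colourable (linked X) (q * K + L)"
proof -
  obtain f g :: "('i \<Rightarrow> 'a) \<Rightarrow> nat" where
    f: "\<And>x. f x < K" "\<And>x y. linked {c \<in> X. p \<notin> snd (snd c)} x y \<Longrightarrow> f x \<noteq> f y" and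
    g: "\<And>x. g x < L" "\<And>x y. linked {c \<in> X. fst c \<noteq> p} x y \<Longrightarrow> g x \<noteq> g y"
    using assms(4,5) unfolding colourable_def by blast
  define h where "h x = (if x p \<in> A then Inl (x p, f x) else Inr (g x))" for x
  show ?thesis
  proof (rule colourableI[where f = h and F = "(A \<times> {..<K}) <+> {..<L}"])
    show "card ((A \<times> {..<K}) <+> {..<L}) \<le> q * K + L"
      using A by (simp add: card_Plus card_cartesian_product)
    show "h x \<noteq> h y" if xy: "linked X x y" for x y
    proof
      assume eq: "h x = h y"
      from xy obtain i where i: "x i \<noteq> y i" "(i, {x i, y i}, {j. x j \<noteq> y j}) \<in> X"
        unfolding linked_def by blast
      show False
      proof (cases "x p \<in> A")
        case True
        with eq have "x p = y p" "f x = f y" by (auto simp: h_def split: if_splits)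
        moreover from this i have "linked {c \<in> X. p \<notin> snd (snd c)} x y"
          unfolding linked_def by auto
        ultimately show False using f(2) by blast
      next
        case False
        with eq have "g x = g y" by (auto simp: h_def split: if_splits)
        moreover have "i \<noteq> p" using A(3)[OF i(2)] False by auto
        with i have "linked {c \<in> X. fst c \<noteq> p} x y"
          unfolding linked_def by auto
        ultimately show False using g(2) by blast
      qed
    qed
  qed (use A f(1) g(1) in \<open>auto simp: h_def\<close>)
qed

text \<open>If some p lies in at least w difference sets, branching on p loses w colours at the price of a
  factor 2s, or one colour for free. Otherwise, by double counting, at most half of the colours have
  more than 2w coordinates of I in their difference set; the others form a sparse relation.\<close>

lemma colourable_linked:
  fixes X :: "('i \<times> 'a set \<times> 'i set) set"
  assumes "0 < w" "finite X" "card X \<le> s" "card X < 2 ^ e"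
    and "\<And>i P v. (i, P, v) \<in> X \<Longrightarrow> finite P \<and> card P \<le> 2"
  shows "colourable (linked X)
    (((s * (2 * s + 1)) ^ (2 * w) + 1) ^ e * (card X + 1) * (2 * s * (s + 1)) ^ (card X div w))"
  using assms(2-5)
proof (induction "card X" arbitrary: X e rule: less_induct)
  case less
  \<comment> \<open>\<open>C\<close> pays for one sparse relation; since each such step at least
    halves \<open>card X\<close>, \<open>e\<close> of them suffice. \<open>D\<close> pays for a
    branching that loses \<open>w\<close> colours: \<open>2 * s\<close> for the values at
    \<open>p\<close>, and \<open>s + 1\<close> to absorb the factor \<open>card ?Y + 1\<close>. The
    factor \<open>card X + 1\<close> pays for the branches that lose a single colour, where the
    numbers of colours add.\<close>
  define C where "C = (s * (2 * s + 1)) ^ (2 * w) + 1"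
  define D where "D = 2 * s * (s + 1)"
  note IH = less.hyps[folded C_def D_def]
  have C: "C \<ge> 1" by (simp add: C_def)
  show ?case unfolding C_def[symmetric] D_def[symmetric]
  proof (cases "X = {}")
    case True
    then show "colourable (linked X) (C ^ e * (card X + 1) * D ^ (card X div w))"
      using C by (auto simp: colourable_def intro: exI[of _ "\<lambda>_. 0"])
  next
    case False
    have fin: "finite X" by fact
    with False have pos: "card X > 0" by (simp add: card_gt_0_iff)
    then have s: "s > 0" using less.prems(2) by simp
    then have D: "D \<ge> 1" by (simp add: D_def)
    obtain e' where e': "e = Suc e'" using less.prems(3) pos by (cases e) auto
    define I where "I = fst ` X"
    define A where "A = (\<Union>c\<in>X. fst (snd c))"
    have finI: "finite I" "card I \<le> card X" using fin by (auto simp: I_def card_image_le)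
    have A: "finite A" "\<And>i P v. (i, P, v) \<in> X \<Longrightarrow> P \<subseteq> A"
      using fin less.prems(4) by (auto simp: A_def intro: rev_bexI)
    have "card A \<le> (\<Sum>c\<in>X. card (fst (snd c)))"
      unfolding A_def by (rule card_UN_le[OF fin])
    also have "\<dots> \<le> (\<Sum>c\<in>X. 2)" using less.prems(4) by (intro sum_mono) auto
    finally have cA: "card A \<le> 2 * card X" by simp
    show "colourable (linked X) (C ^ e * (card X + 1) * D ^ (card X div w))"
    proof (cases "\<exists>p\<in>I. w \<le> card {c \<in> X. p \<in> snd (snd c)}")
      case True
      then obtain p where p: "p \<in> I" "w \<le> card {c \<in> X. p \<in> snd (snd c)}" by blast
      let ?Y = "{c \<in> X. p \<notin> snd (snd c)}" and ?Z = "{c \<in> X. fst c \<noteq> p}"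
      have "card X = card ?Y + card {c \<in> X. p \<in> snd (snd c)}"
        using fin by (subst card_Un_disjoint[symmetric]) (auto intro: arg_cong[where f = card])
      with p(2) have cY: "card ?Y + w \<le> card X" by simp
      have "?Z \<subset> X" using p(1) unfolding I_def by auto
      then have cZ: "card ?Z < card X" using fin psubset_card_mono by blast
      have div: "card X div w = Suc ((card X - w) div w)"
        using cY assms(1) by (simp add: le_div_geq)
      have "colourable (linked ?Y) (C ^ e * (card ?Y + 1) * D ^ (card ?Y div w))"
        using IH[of ?Y e] cY assms(1) fin less.prems by force
      moreover have "C ^ e * (card ?Y + 1) * D ^ (card ?Y div w)
          \<le> C ^ e * (s + 1) * D ^ ((card X - w) div w)"
        using cY less.prems(2) C D by (intro mult_mono power_increasing div_le_mono) auto
      ultimately have Y: "colourable (linked ?Y) (C ^ e * (s + 1) * D ^ ((card X - w) div w))"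
        using colourable_mono by blast
      have "colourable (linked ?Z) (C ^ e * (card ?Z + 1) * D ^ (card ?Z div w))"
        using IH[of ?Z e] cZ fin less.prems by force
      moreover have "C ^ e * (card ?Z + 1) * D ^ (card ?Z div w)
          \<le> C ^ e * card X * D ^ (card X div w)"
        using cZ C D by (intro mult_mono power_increasing div_le_mono) auto
      ultimately have Z: "colourable (linked ?Z) (C ^ e * card X * D ^ (card X div w))"
        using colourable_mono by blast
      have "card A \<le> 2 * s" using cA less.prems(2) by simp
      from colourable_branch[OF A(1) this A(2) Y Z]
      have "colourable (linked X) (2 * s * (C ^ e * (s + 1) * D ^ ((card X - w) div w))
        + C ^ e * card X * D ^ (card X div w))" .
      also have "2 * s * (C ^ e * (s + 1) * D ^ ((card X - w) div w)) = C ^ e * D ^ (card X div w)"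
        unfolding div by (simp add: D_def algebra_simps)
      finally show ?thesis by (simp add: algebra_simps)
    next
      case False
      let ?wt = "\<lambda>c. card (snd (snd c) \<inter> I)"
      let ?Y = "{c \<in> X. ?wt c \<le> 2 * w}" and ?Z = "{c \<in> X. \<not> ?wt c \<le> 2 * w}"
      have "card ?Z * (2 * w) = (\<Sum>c\<in>?Z. 2 * w)" by simp
      also have "\<dots> \<le> (\<Sum>c\<in>?Z. ?wt c)" by (intro sum_mono) auto
      also have "\<dots> \<le> (\<Sum>c\<in>X. ?wt c)" using fin by (intro sum_mono2) auto
      also have "\<dots> = (\<Sum>c\<in>X. card {p \<in> I. p \<in> snd (snd c)})"
        by (intro sum.cong arg_cong[where f = card]) auto
      also have "\<dots> = (\<Sum>p\<in>I. card {c \<in> X. p \<in> snd (snd c)})"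
        using fin finI(1) by (intro sum_multicount_gen) auto
      also have "\<dots> \<le> (\<Sum>p\<in>I. w)" using False by (intro sum_mono) auto
      also have "\<dots> \<le> card X * w" using finI by simp
      finally have half: "2 * card ?Z \<le> card X" using assms(1) by (simp add: algebra_simps)
      have "colourable (linked ?Y) ((s * (2 * s + 1)) ^ (2 * w) + 1)"
        using finI A cA less.prems(2)
        by (intro colourable_sparse[where I = I and A = A]) (auto simp: I_def)
      then have Y: "colourable (linked ?Y) C" by (simp add: C_def)
      have "colourable (linked ?Z) (C ^ e' * (card ?Z + 1) * D ^ (card ?Z div w))"
        using IH[of ?Z e'] half pos fin less.prems e' by force
      from colourable_disj[OF Y this]
      have "colourable (linked X) (C * (C ^ e' * (card ?Z + 1) * D ^ (card ?Z div w)))"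
        by (rule colourable_subrel) (auto simp: linked_def)
      moreover have "C * (C ^ e' * (card ?Z + 1) * D ^ (card ?Z div w))
          \<le> C * (C ^ e' * (card X + 1) * D ^ (card X div w))"
        using half C D by (intro mult_mono power_increasing div_le_mono) auto
      ultimately show ?thesis using e' colourable_mono by (fastforce simp: mult_ac)
    qed
  qed
qed

section \<open>Codes with few agreements\<close>

text \<open>Union bound over the at most \<open>N ^ s\<close> sets of \<open>s\<close> places of
  agreement, each of which leaves \<open>\<rho> ^ (card E - s)\<close> functions. Multiplying by
  \<open>\<rho> ^ s\<close> avoids division.\<close>

lemma card_agreeing_functions:
  fixes g :: "'c \<Rightarrow> nat"
  assumes "finite E" "card E \<le> N"
  shows "card {f \<in> E \<rightarrow>\<^sub>E {..<\<rho>}. s \<le> card {c \<in> E. f c = g c}} * \<rho> ^ s \<le> N ^ s * \<rho> ^ card E"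
    (is "card ?B * _ \<le> _")
proof -
  let ?T = "{S. S \<subseteq> E \<and> card S = s}"
  let ?F = "\<lambda>S. PiE E (\<lambda>c. if c \<in> S then {g c} else {..<\<rho>})"
  have "?B \<subseteq> (\<Union>S\<in>?T. ?F S)"
  proof
    fix f assume f: "f \<in> ?B"
    then have "s \<le> card {c \<in> E. f c = g c}" by simp
    then obtain S where S: "S \<subseteq> {c \<in> E. f c = g c}" "card S = s"
      by (rule obtain_subset_with_card_n)
    then have "f \<in> ?F S" using f by (auto simp: PiE_iff)
    with S show "f \<in> (\<Union>S\<in>?T. ?F S)" by blast
  qed
  moreover have finT: "finite ?T" using assms(1) by simp
  moreover have "finite (?F S)" for S using assms(1) by (intro finite_PiE) auto
  ultimately have "card ?B \<le> card (\<Union>S\<in>?T. ?F S)" by (intro card_mono) auto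
  also have "\<dots> \<le> (\<Sum>S\<in>?T. card (?F S))" by (rule card_UN_le[OF finT])
  also have "\<dots> = (\<Sum>S\<in>?T. \<rho> ^ (card E - s))"
  proof (rule sum.cong[OF refl])
    fix S assume S: "S \<in> ?T"
    then have "finite S" using assms(1) finite_subset by blast
    have "card (?F S) = (\<Prod>c\<in>E. card (if c \<in> S then {g c} else {..<\<rho>}))"
      by (rule card_PiE[OF assms(1)])
    also have "\<dots> = (\<Prod>c\<in>E. if c \<in> S then 1 else \<rho>)" by (intro prod.cong) auto
    also have "\<dots> = \<rho> ^ card (E - S)"
      using assms(1) by (simp add: prod.If_cases Diff_eq Collect_neg_eq)
    also have "card (E - S) = card E - s"
      using S \<open>finite S\<close> by (simp add: card_Diff_subset)
    finally show "card (?F S) = \<rho> ^ (card E - s)" .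
  qed
  also have "\<dots> = (card E choose s) * \<rho> ^ (card E - s)"
    using n_subsets[OF assms(1)] by simp
  finally have "card ?B \<le> (card E choose s) * \<rho> ^ (card E - s)" .
  from mult_le_mono1[OF this, of "\<rho> ^ s"]
  have "card ?B * \<rho> ^ s \<le> (card E choose s) * (\<rho> ^ (card E - s) * \<rho> ^ s)"
    by (simp only: mult.assoc)
  also have "\<dots> \<le> N ^ s * \<rho> ^ card E"
  proof (cases "s \<le> card E")
    case True
    then have "(card E choose s) \<le> N ^ s"
      using order_trans[OF binomial_le_pow power_mono[OF assms(2)]] by simp
    moreover have "\<rho> ^ (card E - s) * \<rho> ^ s = \<rho> ^ card E"
      using True by (simp flip: power_add)
    ultimately show ?thesis by simp
  qed (simp add: binomial_eq_0)
  finally show ?thesis .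
qed

text \<open>Words are chosen greedily. Each of the \<open>m < n\<close> earlier words excludes at
  most the fraction \<open>(N / \<rho>) ^ s \<le> 1 / n\<close> of all functions, so one
  remains.\<close>

lemma gilbert_varshamov:
  assumes E: "finite E" "card E \<le> N" and N: "0 < N" "n * N ^ s \<le> \<rho> ^ s" and "0 < \<rho>"
  shows "\<exists>\<phi> :: nat \<Rightarrow> 'c \<Rightarrow> nat. (\<forall>i<n. \<phi> i \<in> E \<rightarrow>\<^sub>E {..<\<rho>}) \<and>
    (\<forall>i<n. \<forall>j<i. card {c \<in> E. \<phi> i c = \<phi> j c} < s)"
proof -
  have "\<exists>\<phi> :: nat \<Rightarrow> 'c \<Rightarrow> nat. (\<forall>i<m. \<phi> i \<in> E \<rightarrow>\<^sub>E {..<\<rho>}) \<and>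
    (\<forall>i<m. \<forall>j<i. card {c \<in> E. \<phi> i c = \<phi> j c} < s)" if "m \<le> n" for m
    using that
  proof (induction m)
    case 0
    then show ?case by simp
  next
    case (Suc m)
    from Suc.IH[OF Suc_leD[OF Suc.prems]]
    obtain \<phi> :: "nat \<Rightarrow> 'c \<Rightarrow> nat" where \<phi>: "\<And>i. i < m \<Longrightarrow> \<phi> i \<in> E \<rightarrow>\<^sub>E {..<\<rho>}"
      "\<And>i j. i < m \<Longrightarrow> j < i \<Longrightarrow> card {c \<in> E. \<phi> i c = \<phi> j c} < s" by blast
    let ?B = "\<lambda>j. {f \<in> E \<rightarrow>\<^sub>E {..<\<rho>}. s \<le> card {c \<in> E. f c = \<phi> j c}}"
    have "card (\<Union>j<m. ?B j) * \<rho> ^ s \<le> (\<Sum>j<m. card (?B j)) * \<rho> ^ s"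
      by (intro mult_le_mono1 card_UN_le) simp
    also have "\<dots> \<le> (\<Sum>j<m. N ^ s * \<rho> ^ card E)"
      unfolding sum_distrib_right by (intro sum_mono card_agreeing_functions E)
    also have "\<dots> < n * N ^ s * \<rho> ^ card E"
      using Suc.prems N(1) \<open>0 < \<rho>\<close> by simp
    also have "\<dots> \<le> \<rho> ^ s * \<rho> ^ card E" using N(2) by simp
    also have "\<dots> = card (E \<rightarrow>\<^sub>E {..<\<rho>}) * \<rho> ^ s" using E(1) by (simp add: card_PiE mult.commute)
    finally have lt: "card (\<Union>j<m. ?B j) < card (E \<rightarrow>\<^sub>E {..<\<rho>})" by simp
    have fin: "finite (\<Union>j<m. ?B j)" using E(1) by (auto intro!: finite_PiE)
    have "\<not> (E \<rightarrow>\<^sub>E {..<\<rho>}) \<subseteq> (\<Union>j<m. ?B j)"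
    proof
      assume "(E \<rightarrow>\<^sub>E {..<\<rho>}) \<subseteq> (\<Union>j<m. ?B j)"
      from card_mono[OF fin this] lt show False by simp
    qed
    then obtain f where f: "f \<in> E \<rightarrow>\<^sub>E {..<\<rho>}" "f \<notin> (\<Union>j<m. ?B j)" by blast
    then have fm: "card {c \<in> E. f c = \<phi> j c} < s" if "j < m" for j
      using that by (auto simp: not_le)
    show ?case
      using f(1) fm \<phi> by (intro exI[of _ "\<phi>(m := f)"]) (auto simp: less_Suc_eq)
  qed
  then show ?thesis by blast
qed

section \<open>Grids without alternating rectangles\<close>

text \<open>Each block is coloured for the colours of \<open>X\<close> located in it, and the block
  colourings are multiplied. These shares of \<open>X\<close> have total size at most
  \<open>w * q\<close>, so the power of \<open>2 * s * (s + 1)\<close> is \<open>q\<close> for all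
  blocks together, not for each.\<close>

lemma colourable_blocks:
  fixes X :: "(nat \<times> 'i \<times> 'a set \<times> 'i set) set"
  assumes "0 < w" "finite X" "card X \<le> w * q" "w * q < 2 ^ e"
    and P: "\<And>b i P v. (b, i, P, v) \<in> X \<Longrightarrow> finite P \<and> card P \<le> 2"
    and s: "s = w * q"
  shows "colourable (\<lambda>x y. \<exists>b\<in>{..<k}. linked {c. (b, c) \<in> X} (\<lambda>i. x (b, i)) (\<lambda>i. y (b, i)))
    ((((s * (2 * s + 1)) ^ (2 * w) + 1) ^ e * (s + 1)) ^ k * (2 * s * (s + 1)) ^ q)"
proof -
  define C where "C = (s * (2 * s + 1)) ^ (2 * w) + 1"
  define D where "D = 2 * s * (s + 1)"
  define Y where "Y b = {c. (b, c) \<in> X}" for b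
  have finY: "finite (Y b)" for b
    using finite_vimageI[OF assms(2), of "Pair b"] by (auto simp: Y_def vimage_def inj_on_def)
  have "(\<Sum>b<k. card (Y b)) = card (SIGMA b:{..<k}. Y b)" using finY by simp
  also have "\<dots> \<le> card X" by (intro card_mono assms(2)) (auto simp: Y_def)
  finally have sum: "(\<Sum>b<k. card (Y b)) \<le> s" using assms(3) s by simp
  have cY: "card (Y b) \<le> s" if "b < k" for b
    using sum member_le_sum[of b "{..<k}" "\<lambda>b. card (Y b)"] that by simp
  have "colourable (linked (Y b)) (C ^ e * (card (Y b) + 1) * D ^ (card (Y b) div w))" if "b < k" for b
    unfolding C_def D_def
  proof (rule colourable_linked[OF assms(1) finY cY[OF that]])
    show "card (Y b) < 2 ^ e" using cY[OF that] assms(4) s by simp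
  qed (use P in \<open>auto simp: Y_def\<close>)
  note Yb = this
  have "colourable (\<lambda>x y. \<exists>b\<in>{..<k}. linked (Y b) (\<lambda>i. x (b, i)) (\<lambda>i. y (b, i)))
      (\<Prod>b<k. C ^ e * (card (Y b) + 1) * D ^ (card (Y b) div w))"
  proof (rule colourable_Bex)
    show "colourable (\<lambda>x y. linked (Y b) (\<lambda>i. x (b, i)) (\<lambda>i. y (b, i)))
        (C ^ e * (card (Y b) + 1) * D ^ (card (Y b) div w))" if "b \<in> {..<k}" for b
      using colourable_pullback[OF Yb, of b "\<lambda>x i. x (b, i)"] that by simp
  qed simp
  moreover have "(\<Prod>b<k. C ^ e * (card (Y b) + 1) * D ^ (card (Y b) div w)) \<le> (C ^ e * (s + 1)) ^ k * D ^ q"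
  proof -
    have "w * (\<Sum>b<k. card (Y b) div w) \<le> (\<Sum>b<k. card (Y b))"
      unfolding sum_distrib_left by (intro sum_mono) simp
    also have "\<dots> \<le> w * q" using sum s by simp
    finally have "(\<Sum>b<k. card (Y b) div w) \<le> q" using assms(1) by simp
    \<comment> \<open>For \<open>q = 0\<close> also \<open>D = 0\<close>, and powers of
      \<open>D\<close> are not monotone; but then both exponents vanish.\<close>
    moreover have "D \<ge> 1 \<or> (\<Sum>b<k. card (Y b) div w) = 0 \<and> q = 0"
      using s assms(1) calculation by (cases "q = 0") (auto simp: D_def Suc_le_eq)
    ultimately have "D ^ (\<Sum>b<k. card (Y b) div w) \<le> D ^ q"
      by (auto intro: power_increasing)
    moreover have "(\<Prod>b<k. C ^ e * (card (Y b) + 1)) \<le> (\<Prod>b<k. C ^ e * (s + 1))"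
      using cY by (intro prod_mono) auto
    ultimately show ?thesis
      by (simp add: prod.distrib power_sum mult_le_mono)
  qed
  ultimately show ?thesis
    unfolding C_def D_def Y_def by (rule colourable_mono)
qed

text \<open>The grid with rows and columns {..<n}: A a b b' colours the edge of row a between columns
  b < b', and B a a' b colours the edge of column b between rows a < a'. The values at other
  arguments are irrelevant.\<close>

definition rectangle_free ::
    "nat \<Rightarrow> nat \<Rightarrow> (nat \<Rightarrow> nat \<Rightarrow> nat \<Rightarrow> nat) \<Rightarrow> (nat \<Rightarrow> nat \<Rightarrow> nat \<Rightarrow> nat) \<Rightarrow> bool" where
  "rectangle_free n M A B \<longleftrightarrow>
    (\<forall>a b b'. a < n \<longrightarrow> b < b' \<longrightarrow> b' < n \<longrightarrow> A a b b' < M) \<and>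
    (\<forall>a a' b. a < a' \<longrightarrow> a' < n \<longrightarrow> b < n \<longrightarrow> B a a' b < M) \<and>
    (\<forall>a a' b b'. a < a' \<longrightarrow> a' < n \<longrightarrow> b < b' \<longrightarrow> b' < n \<longrightarrow>
       \<not> (A a b b' = A a' b b' \<and> B a a' b = B a a' b'))"

text \<open>Columns are vectors of \<open>k\<close> blocks of \<open>t\<close> coordinates over
  \<open>{..<m}\<close>; rows are code words over \<open>{..<\<rho>}\<close> that pairwise agree on
  fewer than \<open>w * q\<close> colours. If rows \<open>a\<close>, \<open>a'\<close> agree on the
  pair \<open>b\<close>, \<open>b'\<close>, then the colour of that pair is one of the agreed ones,
  and the column colouring chosen for \<open>a\<close>, \<open>a'\<close> is proper on the union of
  these classes, so it separates \<open>b\<close> from \<open>b'\<close>.\<close>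

lemma ex_rectangle_free:
  fixes k t m w q e n \<rho> M :: nat
  assumes pos: "0 < k" "0 < t" "0 < m" "0 < w" and "w * q < 2 ^ e"
    and n: "n \<le> m ^ (k * t)" "n * (k * t * m * m * 2 ^ t) ^ (w * q) \<le> \<rho> ^ (w * q)"
    and \<rho>: "0 < \<rho>" "\<rho> \<le> M"
    and s: "s = w * q"
    and M: "(((s * (2 * s + 1)) ^ (2 * w) + 1) ^ e * (s + 1)) ^ k * (2 * s * (s + 1)) ^ q \<le> M"
  shows "\<exists>A B. rectangle_free n M A B"
proof -
  define J where "J = {..<k} \<times> {..<t}"
  have "card (J \<rightarrow>\<^sub>E {..<m}) = m ^ (k * t)"
    by (simp add: J_def card_PiE card_cartesian_product)
  then obtain \<iota> where \<iota>: "\<iota> ` {..<n} \<subseteq> J \<rightarrow>\<^sub>E {..<m}" "inj_on \<iota> {..<n}"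
    using n(1) card_le_inj[of "{..<n}" "J \<rightarrow>\<^sub>E {..<m}"] by (auto simp: J_def intro!: finite_PiE)
  define diff where "diff x y = (SOME p. p \<in> J \<and> x p \<noteq> y p)" for x y :: "nat \<times> nat \<Rightarrow> nat"
  define \<chi> where "\<chi> x y = (let (b, i) = diff x y in
      (b, i, {x (b, i), y (b, i)}, {j. x (b, j) \<noteq> y (b, j)}))" for x y
  \<comment> \<open>The palette of \<open>\<chi>\<close>. Counting ordered pairs
    \<open>(c, d)\<close> instead of sets \<open>{c, d}\<close> only weakens the upper bound on its
    size.\<close>
  define E where "E = (\<lambda>(b, i, c, d, v). (b, i, {c, d}, v)) `
      ({..<k} \<times> {..<t} \<times> {..<m} \<times> {..<m} \<times> Pow {..<t})"
  have E: "finite E" by (simp add: E_def)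
  have "card E \<le> card ({..<k} \<times> {..<t} \<times> {..<m} \<times> {..<m} \<times> Pow {..<t})"
    unfolding E_def by (rule card_image_le) simp
  then have cE: "card E \<le> k * t * m * m * 2 ^ t"
    by (simp add: card_cartesian_product card_Pow mult.assoc)
  have diff: "diff x y \<in> J" "x (diff x y) \<noteq> y (diff x y)"
    if "x \<in> J \<rightarrow>\<^sub>E {..<m}" "y \<in> J \<rightarrow>\<^sub>E {..<m}" "x \<noteq> y" for x y
  proof -
    have "\<exists>p. p \<in> J \<and> x p \<noteq> y p" using that PiE_ext by blast
    from someI_ex[OF this] show "diff x y \<in> J" "x (diff x y) \<noteq> y (diff x y)"
      unfolding diff_def by auto
  qed
  have \<chi>E: "\<chi> x y \<in> E" if xy: "x \<in> J \<rightarrow>\<^sub>E {..<m}" "y \<in> J \<rightarrow>\<^sub>E {..<m}" "x \<noteq> y" for x y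
  proof -
    obtain b i where bi: "diff x y = (b, i)" by fastforce
    have J: "(b, i) \<in> J" using diff(1)[OF xy] bi by simp
    have "x (b, i) < m" "y (b, i) < m" using J xy(1,2) by auto
    \<comment> \<open>Outside \<open>J\<close> both vectors take the same default value, so no
      differences arise there.\<close>
    moreover have "{j. x (b, j) \<noteq> y (b, j)} \<subseteq> {..<t}"
    proof (intro subsetI, rule ccontr)
      fix j assume j: "j \<in> {j. x (b, j) \<noteq> y (b, j)}" "j \<notin> {..<t}"
      then have "(b, j) \<notin> J" by (simp add: J_def)
      then show False using j(1) PiE_arb[OF xy(1)] PiE_arb[OF xy(2)] by simp
    qed
    ultimately show ?thesis
      using J unfolding E_def \<chi>_def bi
      by (intro image_eqI[of _ _ "(b, i, x (b, i), y (b, i), {j. x (b, j) \<noteq> y (b, j)})"]) (auto simp: J_def)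
  qed
  have N: "0 < k * t * m * m * 2 ^ t" using pos by simp
  from gilbert_varshamov[OF E cE N n(2) \<rho>(1)]
  obtain \<phi> :: "nat \<Rightarrow> nat \<times> nat \<times> nat set \<times> nat set \<Rightarrow> nat" where
    \<phi>: "\<And>a. a < n \<Longrightarrow> \<phi> a \<in> E \<rightarrow>\<^sub>E {..<\<rho>}"
    "\<And>a a'. a' < n \<Longrightarrow> a < a' \<Longrightarrow> card {c \<in> E. \<phi> a' c = \<phi> a c} < w * q" by blast
  \<comment> \<open>\<open>R X\<close> contains all pairs whose \<open>\<chi>\<close>-colour lies in
    \<open>X\<close>, whichever coordinate \<open>diff\<close> selects.\<close>
  define R where "R X x y \<longleftrightarrow> (\<exists>b\<in>{..<k}. linked {c. (b, c) \<in> X} (\<lambda>i. x (b, i)) (\<lambda>i. y (b, i)))"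
    for X and x y :: "nat \<times> nat \<Rightarrow> nat"
  have "colourable (R {c \<in> E. \<phi> a' c = \<phi> a c}) M" if "a < a'" "a' < n" for a a'
  proof (rule colourable_mono[OF _ M])
    show "colourable (R {c \<in> E. \<phi> a' c = \<phi> a c})
      ((((s * (2 * s + 1)) ^ (2 * w) + 1) ^ e * (s + 1)) ^ k * (2 * s * (s + 1)) ^ q)"
      unfolding R_def using \<phi>(2)[OF that(2,1)] E assms(5) pos s
      by (intro colourable_blocks) (auto simp: E_def card_insert_if)
  qed
  then have ex: "\<exists>f :: (nat \<times> nat \<Rightarrow> nat) \<Rightarrow> nat. (\<forall>x. f x < M) \<and>
      (\<forall>x y. R {c \<in> E. \<phi> a' c = \<phi> a c} x y \<longrightarrow> f x \<noteq> f y)" if "a < a'" "a' < n" for a a'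
    using that unfolding colourable_def by blast
  define f where "f a a' = (SOME f :: (nat \<times> nat \<Rightarrow> nat) \<Rightarrow> nat. (\<forall>x. f x < M) \<and>
      (\<forall>x y. R {c \<in> E. \<phi> a' c = \<phi> a c} x y \<longrightarrow> f x \<noteq> f y))" for a a'
  note f_spec = someI_ex[OF ex, folded f_def]
  have f: "f a a' x < M" "R {c \<in> E. \<phi> a' c = \<phi> a c} x y \<Longrightarrow> f a a' x \<noteq> f a a' y"
    if "a < a'" "a' < n" for a a' x y
    using f_spec[OF that] by blast+
  have \<iota>b: "\<iota> b \<in> J \<rightarrow>\<^sub>E {..<m}" if "b < n" for b using \<iota>(1) that by auto
  have \<iota>ne: "\<iota> b \<noteq> \<iota> b'" if "b < b'" "b' < n" for b b'
    using inj_onD[OF \<iota>(2), of b b'] that by auto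
  show ?thesis
    unfolding rectangle_free_def
  proof (rule exI[of _ "\<lambda>a b b'. \<phi> a (\<chi> (\<iota> b) (\<iota> b'))"], rule exI[of _ "\<lambda>a a' b. f a a' (\<iota> b)"],
      intro conjI allI impI notI; (elim conjE)?)
    fix a b b' assume ab: "a < n" "b < b'" "b' < n"
    then have "\<chi> (\<iota> b) (\<iota> b') \<in> E" by (intro \<chi>E \<iota>b \<iota>ne) auto
    then show "\<phi> a (\<chi> (\<iota> b) (\<iota> b')) < M" using \<phi>(1)[OF ab(1)] \<rho>(2) by force
  next
    fix a a' b assume "a < a'" "a' < n" "b < n"
    then show "f a a' (\<iota> b) < M" by (intro f)
  next
    fix a a' b b' assume ab: "a < a'" "a' < n" "b < b'" "b' < n"
      and eq: "\<phi> a (\<chi> (\<iota> b) (\<iota> b')) = \<phi> a' (\<chi> (\<iota> b) (\<iota> b'))" "f a a' (\<iota> b) = f a a' (\<iota> b')"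
    have V: "\<iota> b \<in> J \<rightarrow>\<^sub>E {..<m}" "\<iota> b' \<in> J \<rightarrow>\<^sub>E {..<m}" "\<iota> b \<noteq> \<iota> b'"
      using \<iota>b[of b] \<iota>b[of b'] \<iota>ne[OF ab(3,4)] ab by auto
    obtain c i where ci: "diff (\<iota> b) (\<iota> b') = (c, i)" by fastforce
    have "c < k" "\<iota> b (c, i) \<noteq> \<iota> b' (c, i)" using diff[OF V] ci by (auto simp: J_def)
    moreover have "(c, i, {\<iota> b (c, i), \<iota> b' (c, i)}, {j. \<iota> b (c, j) \<noteq> \<iota> b' (c, j)})
        \<in> {c \<in> E. \<phi> a' c = \<phi> a c}"
      using \<chi>E[OF V] eq(1) unfolding \<chi>_def ci by simp
    ultimately have "R {c \<in> E. \<phi> a' c = \<phi> a c} (\<iota> b) (\<iota> b')"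
      unfolding R_def linked_def by (intro bexI[of _ c] exI[of _ i]) auto
    then show False using f(2)[OF ab(1,2)] eq(2) by blast
  qed
qed

lemma mult_le_power2: "a \<le> 2 ^ i \<Longrightarrow> b \<le> 2 ^ j \<Longrightarrow> a * b \<le> 2 ^ (i + j)" for a b :: nat
  by (simp add: power_add mult_le_mono)

lemma power_le_power2: "a \<le> 2 ^ i \<Longrightarrow> a ^ k \<le> 2 ^ (i * k)" for a :: nat
  by (simp add: power_mono power_mult)

lemma Suc_le_power2: "a \<le> 2 ^ i \<Longrightarrow> a + 1 \<le> 2 ^ (i + 1)" for a :: nat
  using add_mono[of a "2 ^ i" 1 "2 ^ i"] by simp

text \<open>With l = 2 ^ j: vectors consist of l blocks of l^2 coordinates over an alphabet of size
  2 ^ l^2, and two rows may agree on fewer than l^3 colours.\<close>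

lemma ex_rectangle_free_power2:
  assumes "n \<le> 2 ^ (32 ^ j)" and M: "M = (2::nat) ^ (100 * (j + 1)\<^sup>2 * 4 ^ j)"
  shows "\<exists>A B. rectangle_free n M A B"
proof -
  define l :: nat where "l = 2 ^ j"
  define m :: nat where "m = 2 ^ l\<^sup>2"
  define s where "s = l * l\<^sup>2"
  define N where "N = l * l\<^sup>2 * m * m * 2 ^ l\<^sup>2"
  have l: "l \<ge> 1" by (simp add: l_def)
  have l2: "l\<^sup>2 = 4 ^ j" by (simp add: l_def power2_eq_square flip: power_mult_distrib)
  have s: "s = 2 ^ (3 * j)" by (simp add: s_def l_def numeral_3_eq_3 power_add flip: power2_eq_square power_mult)
  \<comment> \<open>There are \<open>m ^ (l ^ 3) = 2 ^ (l ^ 5)\<close> vectors, against about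
    \<open>2 ^ (l ^ 2)\<close> colours up to factors \<open>(j + 1)\<^sup>2\<close> in the exponent:
    this ratio is the source of 2/5.\<close>
  have l5: "l\<^sup>2 * s = 32 ^ j"
    by (simp add: l2 s power_mult flip: power_mult_distrib)
  have mm: "m ^ s = 2 ^ (32 ^ j)" unfolding m_def l5[symmetric] by (rule power_mult[symmetric])
  have N: "N = 2 ^ (3 * j + 3 * l\<^sup>2)"
    unfolding N_def m_def s_def[symmetric] s by (simp add: power_add numeral_3_eq_3)
  have jl: "j + 1 \<le> l" using Suc_leI[OF less_exp[of j]] by (simp add: l_def)
  show ?thesis
  \<comment> \<open>With \<open>\<rho> = m * N\<close>, \<open>\<rho> ^ s\<close> equals
    \<open>2 ^ (32 ^ j) * N ^ s\<close>, just enough for \<open>n\<close> code words;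
    \<open>e = 3 * j + 1\<close> since \<open>s = 2 ^ (3 * j)\<close>.\<close>
  proof (rule ex_rectangle_free[of l "l\<^sup>2" m l "l\<^sup>2" "3 * j + 1" n "m * N" M s])
    show "l * l\<^sup>2 < 2 ^ (3 * j + 1)" using s by (simp add: s_def)
    show "n \<le> m ^ (l * l\<^sup>2)" using assms(1) mm by (simp add: s_def)
    show "n * (l * l\<^sup>2 * m * m * 2 ^ l\<^sup>2) ^ (l * l\<^sup>2) \<le> (m * N) ^ (l * l\<^sup>2)"
      unfolding N_def[symmetric] power_mult_distrib using assms(1) mm by (simp add: s_def)
    show "m * N \<le> M"
    proof -
      have "m * N = 2 ^ (3 * j + 4 * l\<^sup>2)" unfolding m_def N by (simp add: power_add[symmetric])
      also have "3 * j + 4 * l\<^sup>2 \<le> 100 * (j + 1)\<^sup>2 * 4 ^ j"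
      proof -
        have "j \<le> l\<^sup>2" using jl le_square[of l] unfolding power2_eq_square by linarith
        then have "3 * j + 4 * l\<^sup>2 \<le> 7 * l\<^sup>2" by simp
        also have "\<dots> \<le> 100 * (j + 1)\<^sup>2 * l\<^sup>2"
          by (intro mult_le_mono1) (simp add: algebra_simps power2_eq_square)
        finally show ?thesis by (simp add: l2)
      qed
      finally show ?thesis unfolding M by (simp add: power_increasing)
    qed
    show "(((s * (2 * s + 1)) ^ (2 * l) + 1) ^ (3 * j + 1) * (s + 1)) ^ l * (2 * s * (s + 1)) ^ l\<^sup>2 \<le> M"
    proof -
      have s1: "s + 1 \<le> 2 ^ (3 * j + 1)" using Suc_le_power2[of s "3 * j"] s by simp
      have "2 * s + 1 \<le> 2 ^ (3 * j + 1 + 1)"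
        using Suc_le_power2[of "2 * s" "3 * j + 1"] s by simp
      then have "s * (2 * s + 1) \<le> 2 ^ (3 * j + (3 * j + 1 + 1))"
        using s by (intro mult_le_power2) auto
      then have 1: "(s * (2 * s + 1)) ^ (2 * l) + 1 \<le> 2 ^ ((3 * j + (3 * j + 1 + 1)) * (2 * l) + 1)"
        by (intro Suc_le_power2 power_le_power2)
      have D: "2 * s * (s + 1) \<le> 2 ^ (3 * j + 1 + (3 * j + 1))"
        using s by (intro mult_le_power2[OF _ s1]) simp
      \<comment> \<open>The leading term of this exponent is \<open>36 * j ^ 2 * l ^ 2\<close>; the
        constant 100 in \<open>M\<close> leaves room for the rest.\<close>
      define x where "x = (((3 * j + (3 * j + 1 + 1)) * (2 * l) + 1) * (3 * j + 1) + (3 * j + 1)) * l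
        + (3 * j + 1 + (3 * j + 1)) * l\<^sup>2"
      have "(((s * (2 * s + 1)) ^ (2 * l) + 1) ^ (3 * j + 1) * (s + 1)) ^ l * (2 * s * (s + 1)) ^ l\<^sup>2
          \<le> 2 ^ x"
        unfolding x_def by (intro mult_le_power2 power_le_power2 1 s1 D)
      moreover have "x \<le> 100 * (j + 1)\<^sup>2 * 4 ^ j"
      proof -
        have "(3 * j + (3 * j + 1 + 1)) * (2 * l) + 1 + 1 \<le> (12 * j + 6) * l"
          using l by (simp add: algebra_simps)
        then have "((3 * j + (3 * j + 1 + 1)) * (2 * l) + 1 + 1) * ((3 * j + 1) * l)
            \<le> (12 * j + 6) * l * ((3 * j + 1) * l)"
          by (rule mult_le_mono1)
        then have "x \<le> ((12 * j + 6) * (3 * j + 1) + (6 * j + 2)) * l\<^sup>2"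
          unfolding x_def by (simp add: algebra_simps power2_eq_square)
        also have "\<dots> \<le> 100 * (j + 1)\<^sup>2 * l\<^sup>2"
          by (intro mult_le_mono1) (simp add: algebra_simps power2_eq_square)
        finally show ?thesis using l2 by simp
      qed
      ultimately show ?thesis
        unfolding M by (meson le_trans one_le_numeral power_increasing)
    qed
  qed (use l in \<open>auto simp: m_def N s_def\<close>)
qed

section \<open>Splitting heights in the binary tree\<close>

text \<open>The height of the lowest common ancestor of the leaves x and y in the binary tree.\<close>

definition split_level :: "nat \<Rightarrow> nat \<Rightarrow> nat" where
  "split_level x y = (LEAST k. x div 2 ^ k = y div 2 ^ k)"

text \<open>Leaves with a common ancestor at one height share all higher ones, and at height
  \<open>x + y\<close> both ancestors are 0, so the minimum is attained.\<close>

lemma split_level_le_iff: "split_level x y \<le> k \<longleftrightarrow> x div 2 ^ k = y div 2 ^ k"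
proof
  have up: "x div 2 ^ l = y div 2 ^ l" if "x div 2 ^ k = y div 2 ^ k" "k \<le> l" for k l
    using that div_mult2_eq[of _ "2 ^ k" "2 ^ (l - k)"] by (simp flip: power_add)
  have "x < 2 ^ (x + y)" "y < 2 ^ (x + y)"
    by (rule less_le_trans[OF less_exp power_increasing]; simp)+
  then have "x div 2 ^ (x + y) = y div 2 ^ (x + y)" by simp
  then have "x div 2 ^ split_level x y = y div 2 ^ split_level x y"
    unfolding split_level_def by (rule LeastI)
  then show "x div 2 ^ k = y div 2 ^ k" if "split_level x y \<le> k"
    using up that by blast
  show "split_level x y \<le> k" if "x div 2 ^ k = y div 2 ^ k"
    unfolding split_level_def using that by (rule Least_le)
qed

lemma split_level_le: "x < 2 ^ T \<Longrightarrow> y < 2 ^ T \<Longrightarrow> split_level x y \<le> T"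
  by (simp add: split_level_le_iff)

text \<open>Taking ancestors preserves order, so an ancestor common to \<open>x\<close> and
  \<open>z\<close> is also one of \<open>y\<close> at that height.\<close>

lemma split_level_max:
  assumes "x \<le> y" "y \<le> z"
  shows "split_level x z = max (split_level x y) (split_level y z)"
proof -
  have "split_level x z \<le> k \<longleftrightarrow> max (split_level x y) (split_level y z) \<le> k" for k
    using div_le_mono[OF assms(1), of "2 ^ k"] div_le_mono[OF assms(2), of "2 ^ k"]
    by (auto simp: split_level_le_iff)
  then show ?thesis by (metis nle_le order_refl)
qed

text \<open>With equal heights, the ancestors of the three leaves just below would be three distinct
  children of one node.\<close>

lemma split_level_neq:
  assumes "x < y" "y < z"
  shows "split_level x y \<noteq> split_level y z"
proof
  assume eq: "split_level x y = split_level y z"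
  obtain k where k: "split_level x y = Suc k"
    using assms(1) split_level_le_iff[of x y 0] by (cases "split_level x y") auto
  let ?d = "\<lambda>u. u div 2 ^ k"
  have "?d x \<noteq> ?d y" "?d y \<noteq> ?d z"
    using k eq split_level_le_iff[of x y k] split_level_le_iff[of y z k] by auto
  moreover have "?d x \<le> ?d y" "?d y \<le> ?d z" using assms by (auto intro: div_le_mono)
  moreover have "?d x div 2 = ?d y div 2" "?d y div 2 = ?d z div 2"
    using k eq split_level_le_iff[of x y "Suc k"] split_level_le_iff[of y z "Suc k"]
    by (simp_all add: div_mult2_eq[symmetric] mult.commute)
  ultimately show False by linarith
qed

section \<open>From the grid to the hypergraph colouring\<close>

text \<open>Allows tuples and tables as colours: an injective renaming of the palette keeps the
  number of colours on every vertex set.\<close>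

lemma erdos_gyarfas_le_card:
  assumes "finite P" "P \<noteq> {}" "c \<in> nsets {..<n} r \<rightarrow> P" "pq_colouring r {..<n} p q c"
  shows "erdos_gyarfas r n p q \<le> card P"
proof -
  obtain h where h: "bij_betw h P {0..<card P}"
    using ex_bij_betw_finite_nat[OF assms(1)] by blast
  have "h \<circ> c \<in> nsets {..<n} r \<rightarrow> {..<card P}"
    using bij_betwE[OF h] assms(3) by fastforce
  moreover have "pq_colouring r {..<n} p q (h \<circ> c)"
    unfolding pq_colouring_def
  proof
    fix S assume S: "S \<in> nsets {..<n} p"
    have "c ` nsets S r \<subseteq> P"
      using S assms(3) by (force simp: nsets_def)
    then have "card ((h \<circ> c) ` nsets S r) = card (c ` nsets S r)"
      unfolding image_comp[symmetric]
      using bij_betw_imp_inj_on[OF h] by (intro card_image) (rule inj_on_subset)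
    then show "q \<le> card ((h \<circ> c) ` nsets S r)"
      using assms(4) S by (simp add: pq_colouring_def)
  qed
  moreover have "0 < card P" using assms(1,2) by (simp add: card_gt_0_iff)
  ultimately show ?thesis
    unfolding erdos_gyarfas_def by (intro Least_le) blast
qed

text \<open>To be used with \<open>F i\<close> the colour of the \<open>r\<close>-subset omitting
  the \<open>i\<close>-th vertex. Dropping the second index of the only coincidence makes
  \<open>F\<close> injective.\<close>

lemma card_image_one_coincidence:
  assumes adj: "\<And>i j. i < j \<Longrightarrow> j \<le> r \<Longrightarrow> F i = F j \<Longrightarrow> j = Suc i"
    and one: "\<And>i j. i < j \<Longrightarrow> Suc j \<le> r \<Longrightarrow> F i = F (Suc i) \<Longrightarrow> F j \<noteq> F (Suc j)"
  shows "r \<le> card (F ` {..r})"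
proof (cases "\<exists>i. Suc i \<le> r \<and> F i = F (Suc i)")
  case False
  then have "inj_on F {..r}"
    using adj by (intro linorder_inj_onI) fastforce+
  then show ?thesis by (simp add: card_image)
next
  case True
  then obtain i where i: "Suc i \<le> r" "F i = F (Suc i)" by blast
  have "inj_on F ({..r} - {Suc i})"
  proof (intro linorder_inj_onI)
    fix x y assume xy: "x < y" "x \<in> {..r} - {Suc i}" "y \<in> {..r} - {Suc i}"
    show "F x \<noteq> F y"
    proof
      assume eq: "F x = F y"
      have y: "y = Suc x" using adj[OF xy(1) _ eq] xy(3) by simp
      show False
        using one[of i x] one[of x i] i eq xy y by (cases i x rule: linorder_cases) auto
    qed
  qed auto
  then have "card (F ` ({..r} - {Suc i})) = r" using i by (simp add: card_image)
  moreover have "card (F ` ({..r} - {Suc i})) \<le> card (F ` {..r})" by (intro card_mono) auto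
  ultimately show ?thesis by simp
qed

lemma sorted_list_of_set_strict_mono_image:
  fixes f :: "nat \<Rightarrow> nat"
  assumes "strict_mono_on {..<r} f"
  shows "sorted_list_of_set (f ` {..<r}) = map f [0..<r]"
proof -
  have inj: "inj_on f {..<r}" using assms by (rule strict_mono_on_imp_inj_on)
  have "sorted (map f [0..<r])"
    using strict_mono_on_leD[OF assms] by (auto simp: sorted_iff_nth_mono)
  moreover have "distinct (map f [0..<r])" using inj by (simp add: distinct_map lessThan_atLeast0)
  moreover have "set (map f [0..<r]) = f ` {..<r}" by (simp add: lessThan_atLeast0)
  ultimately show ?thesis
    by (metis sorted_list_of_set.idem_if_sorted_distinct)
qed

lemma erdos_gyarfas_le_grid:
  assumes "n \<le> 2 ^ T" "0 < M" "3 \<le> r" and AB: "rectangle_free n M A B"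
  shows "erdos_gyarfas r n (r + 1) r \<le> (T + 1) ^ (r * r) * M ^ (r * (r * r))"
proof -
  \<comment> \<open>The first case is the split x | yz: row \<open>x\<close>, columns
    \<open>y\<close> and \<open>z\<close>. Otherwise the split is xy | z: rows \<open>x\<close> and
    \<open>y\<close>, column \<open>z\<close>.\<close>
  define g where "g x y z = (if split_level y z < split_level x y then A x y z else B x y z)" for x y z
  define P2 where "P2 = {..<r} \<times> {..<r} \<rightarrow>\<^sub>E {..T}"
  define P3 where "P3 = {..<r} \<times> {..<r} \<times> {..<r} \<rightarrow>\<^sub>E {..<M}"
  \<comment> \<open>The tables are indexed by positions in the sorted edge, so that different edges
    can be compared; entries at non-increasing positions are set to 0.\<close>
  define c2 where "c2 E = (\<lambda>(p, q)\<in>{..<r} \<times> {..<r}. let f = (!) (sorted_list_of_set E) in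
      if p < q then split_level (f p) (f q) else 0)" for E :: "nat set"
  define c3 where "c3 E = (\<lambda>(p, q, u)\<in>{..<r} \<times> {..<r} \<times> {..<r}. let f = (!) (sorted_list_of_set E) in
      if p < q \<and> q < u then g (f p) (f q) (f u) else 0)" for E :: "nat set"
  have g: "g x y z < M" if "x < y" "y < z" "z < n" for x y z
    using AB that by (simp add: g_def rectangle_free_def)
  have "card (P2 \<times> P3) = (T + 1) ^ (r * r) * M ^ (r * (r * r))"
    by (simp add: P2_def P3_def card_cartesian_product card_PiE)
  moreover have "erdos_gyarfas r n (r + 1) r \<le> card (P2 \<times> P3)"
  proof (rule erdos_gyarfas_le_card)
    show "finite (P2 \<times> P3)" by (auto simp: P2_def P3_def intro!: finite_PiE)
    show "P2 \<times> P3 \<noteq> {}" using assms(2) by (auto simp: P2_def P3_def PiE_eq_empty_iff)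
    show "(\<lambda>E. (c2 E, c3 E)) \<in> nsets {..<n} r \<rightarrow> P2 \<times> P3"
    proof
      fix E assume "E \<in> nsets {..<n} r"
      then have E: "E \<subseteq> {..<n}" "finite E" "card E = r" by (auto simp: nsets_def)
      define f where "f = (!) (sorted_list_of_set E)"
      have fn: "f p < n" if "p < r" for p
        using that E nth_mem[of p "sorted_list_of_set E"] by (auto simp: f_def)
      have fm: "f p < f q" if "p < q" "q < r" for p q
        using sorted_wrt_nth_less[OF strict_sorted_list_of_set[of E] that(1)] that E by (simp add: f_def)
      have "split_level (f p) (f q) \<le> T" if "p < r" "q < r" for p q
        using fn[OF that(1)] fn[OF that(2)] assms(1) by (intro split_level_le) auto
      then have "c2 E \<in> P2"
        unfolding c2_def P2_def Let_def f_def[symmetric] by auto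
      moreover have "c3 E \<in> P3"
        unfolding c3_def P3_def Let_def f_def[symmetric] using assms(2) by (auto intro!: g fm fn)
      ultimately show "(c2 E, c3 E) \<in> P2 \<times> P3" by simp
    qed
    show "pq_colouring r {..<n} (r + 1) r (\<lambda>E. (c2 E, c3 E))"
      unfolding pq_colouring_def
    proof
      fix S assume "S \<in> nsets {..<n} (r + 1)"
      then have S: "S \<subseteq> {..<n}" "finite S" "card S = Suc r" by (auto simp: nsets_def)
      define y where "y = (!) (sorted_list_of_set S)"
      have yS: "y p \<in> S" if "p \<le> r" for p
        using that S nth_mem[of p "sorted_list_of_set S"] by (simp add: y_def)
      then have yn: "y p < n" if "p \<le> r" for p
        using that S by blast
      have ym: "y p < y q" if "p < q" "q \<le> r" for p q
        using sorted_wrt_nth_less[OF strict_sorted_list_of_set[of S] that(1)] that S by (simp add: y_def)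
      \<comment> \<open>\<open>d i\<close> enumerates \<open>{..r}\<close> without \<open>i\<close>,
        so \<open>E i\<close> is \<open>S\<close> without \<open>y i\<close>.\<close>
      define d where "d i p = (if p < i then p else Suc p)" for i p :: nat
      define E where "E i = (y \<circ> d i) ` {..<r}" for i
      have mono: "strict_mono_on {..<r} (y \<circ> d i)" for i
        by (intro strict_mono_onI) (auto simp: d_def intro!: ym)
      have nth: "sorted_list_of_set (E i) ! p = y (d i p)" if "p < r" for i p
        unfolding E_def sorted_list_of_set_strict_mono_image[OF mono] using that by simp
      have E: "E i \<in> nsets S r" for i
        using card_image[OF strict_mono_on_imp_inj_on[OF mono[of i]]] yS
        by (auto simp: nsets_def E_def d_def)
      define F where "F i = (c2 (E i), c3 (E i))" for i
      have F2: "split_level (y (d i p)) (y (d i q)) = split_level (y (d j p)) (y (d j q))"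
        if "F i = F j" "p < q" "q < r" for i j p q
      proof -
        have "c2 (E i) = c2 (E j)" using that(1) by (simp add: F_def)
        from fun_cong[OF this, of "(p, q)"] show ?thesis using that by (simp add: c2_def nth)
      qed
      have F3: "g (y (d i p)) (y (d i q)) (y (d i u)) = g (y (d j p)) (y (d j q)) (y (d j u))"
        if "F i = F j" "p < q" "q < u" "u < r" for i j p q u
      proof -
        have "c3 (E i) = c3 (E j)" using that(1) by (simp add: F_def)
        from fun_cong[OF this, of "(p, q, u)"] show ?thesis using that by (simp add: c3_def nth)
      qed
      have adj: "j = Suc i" if ij: "i < j" "j \<le> r" "F i = F j" for i j
      proof (rule ccontr)
        assume "j \<noteq> Suc i"
        then have "Suc i < j" using ij by simp
        \<comment> \<open>The vertices at positions \<open>i\<close>, \<open>i + 1\<close> are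
          \<open>y (i + 1)\<close>, \<open>y (i + 2)\<close> in \<open>E i\<close> but
          \<open>y i\<close>, \<open>y (i + 1)\<close> in \<open>E j\<close>; equal colours would
          give two consecutive splits of equal height.\<close>
        then show False
          using F2[OF ij(3), of i "Suc i"] split_level_neq[of "y i" "y (Suc i)" "y (Suc (Suc i))"] ij
          by (simp add: d_def ym)
      qed
      have "r \<le> card (F ` {..r})"
      proof (rule card_image_one_coincidence)
        show "j = Suc i" if "i < j" "j \<le> r" "F i = F j" for i j
          using that by (rule adj)
        show "F j \<noteq> F (Suc j)" if ij: "i < j" "Suc j \<le> r" "F i = F (Suc i)" for i j
        proof
          assume eq: "F j = F (Suc j)"
          \<comment> \<open>Otherwise \<open>F i = F (i + 2)\<close>, against
            \<open>adj\<close>.\<close>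
          have "j \<noteq> Suc i"
            using adj[of i "Suc j"] ij eq by auto
          then have lt: "Suc i < j" using ij by simp
          define a a' b b' where defs: "a = y i" "a' = y (Suc i)" "b = y j" "b' = y (Suc j)"
          have ord: "a < a'" "a' < b" "b < b'" "b' < n"
            unfolding defs using lt ij(2) by (auto intro!: ym yn)
          \<comment> \<open>Passing from \<open>E i\<close> to \<open>E (i + 1)\<close> replaces
            \<open>a'\<close> by \<open>a\<close> at position \<open>i\<close> and keeps
            \<open>b\<close>, \<open>b'\<close>; similarly \<open>F j = F (j + 1)\<close> exchanges
            \<open>b'\<close> and \<open>b\<close>.\<close>
          have "split_level a' b = split_level a b" "g a' b b' = g a b b'"
            using F2[OF ij(3), of i "j - 1"] F3[OF ij(3), of i "j - 1" j] lt ij(2)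
            unfolding defs by (auto simp: d_def)
          moreover have "split_level a' b' = split_level a' b" "g a a' b' = g a a' b"
            using F2[OF eq, of "Suc i" j] F3[OF eq, of i "Suc i" j] lt ij(2)
            unfolding defs by (auto simp: d_def)
          \<comment> \<open>The maxima and inequalities force the pairs \<open>a\<close>,
            \<open>a'\<close> and \<open>b\<close>, \<open>b'\<close> to split below the height of
            \<open>a'\<close>, \<open>b\<close>. So the top split is aa' | bb', and the equalities
            of \<open>g\<close> become the row and column equalities of an alternating
            rectangle.\<close>
          moreover have "split_level a b = max (split_level a a') (split_level a' b)"
            "split_level a' b' = max (split_level a' b) (split_level b b')"
            using ord by (auto intro!: split_level_max)
          moreover have "split_level a a' \<noteq> split_level a' b" "split_level a' b \<noteq> split_level b b'"
            using split_level_neq[OF ord(1,2)] split_level_neq[OF ord(2,3)] by auto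
          ultimately have "A a' b b' = A a b b'" "B a a' b' = B a a' b"
            by (auto simp: g_def max_def split: if_splits)
          then show False using AB ord unfolding rectangle_free_def by (metis less_trans)
        qed
      qed
      also have "\<dots> \<le> card ((\<lambda>E. (c2 E, c3 E)) ` nsets S r)"
        using E S(2) by (intro card_mono) (auto simp: F_def finite_imp_finite_nsets)
      finally show "r \<le> card ((\<lambda>E. (c2 E, c3 E)) ` nsets S r)" .
    qed
  qed
  ultimately show ?thesis by simp
qed

text \<open>With trees of height \<open>32 ^ j\<close>, the splitting heights add only
  \<open>(5 * j + 1) * (r * r)\<close> to the exponent, which the grid colours dominate.\<close>

lemma erdos_gyarfas_le_power2:
  assumes "3 \<le> r" "n \<le> 2 ^ (32 ^ j)"
  shows "erdos_gyarfas r n (r + 1) r \<le> 2 ^ (200 * r ^ 3 * (j + 1)\<^sup>2 * 4 ^ j)"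
proof -
  define M :: nat where "M = 2 ^ (100 * (j + 1)\<^sup>2 * 4 ^ j)"
  obtain A B where "rectangle_free n M A B"
    using ex_rectangle_free_power2[OF assms(2) M_def] by blast
  then have "erdos_gyarfas r n (r + 1) r \<le> (32 ^ j + 1) ^ (r * r) * M ^ (r * (r * r))"
    using assms by (intro erdos_gyarfas_le_grid) (auto simp: M_def)
  also have "\<dots> \<le> 2 ^ ((5 * j + 1) * (r * r) + 100 * (j + 1)\<^sup>2 * 4 ^ j * (r * (r * r)))"
  proof -
    have "(32::nat) ^ j \<le> 2 ^ (5 * j)" by (simp add: power_mult)
    then show ?thesis
      unfolding M_def by (intro mult_le_power2 power_le_power2 Suc_le_power2) auto
  qed
  also have "\<dots> \<le> 2 ^ (200 * r ^ 3 * (j + 1)\<^sup>2 * 4 ^ j)"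
  proof (rule power_increasing)
    have "(5 * j + 1) * (r * r) \<le> (100 * (j + 1)\<^sup>2 * 4 ^ j) * (r * (r * r))"
    proof (rule mult_le_mono)
      have "5 * j + 1 \<le> 100 * (j + 1)\<^sup>2 * 1" by (simp add: power2_eq_square)
      also have "\<dots> \<le> 100 * (j + 1)\<^sup>2 * 4 ^ j" by (intro mult_le_mono2) simp
      finally show "5 * j + 1 \<le> 100 * (j + 1)\<^sup>2 * 4 ^ j" .
    qed (use assms(1) in simp)
    then show "(5 * j + 1) * (r * r) + 100 * (j + 1)\<^sup>2 * 4 ^ j * (r * (r * r))
        \<le> 200 * r ^ 3 * (j + 1)\<^sup>2 * 4 ^ j"
      by (simp add: power3_eq_cube mult_ac)
  qed simp
  finally show ?thesis .
qed

section \<open>Asymptotics\<close>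

text \<open>For u = log log n, this absorbs the polynomial factor in u into (log n)^o(1).
  Substituting u = v^2 reduces it to v^4 = o(exp v).\<close>

lemma eventually_square_le_exp_sqrt:
  fixes K :: real
  assumes "0 < K"
  shows "\<forall>\<^sub>F u in at_top. K * (u + 3)\<^sup>2 \<le> exp (sqrt u)"
proof -
  have "\<forall>\<^sub>F v :: real in at_top. v ^ 4 / exp v < 1 / (4 * K)"
    using tendsto_power_div_exp_0[of 4] assms by (intro order_tendstoD) auto
  then have "\<forall>\<^sub>F v in at_top. K * (v\<^sup>2 + 3)\<^sup>2 \<le> exp v"
    using eventually_ge_at_top[of 2]
  proof eventually_elim
    case (elim v)
    have "4 \<le> v\<^sup>2" using power_mono[of 2 v 2] elim by simp
    then have "(v\<^sup>2 + 3)\<^sup>2 \<le> (2 * v\<^sup>2)\<^sup>2" by (intro power_mono) auto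
    then have "K * (v\<^sup>2 + 3)\<^sup>2 \<le> K * (2 * v\<^sup>2)\<^sup>2" using assms by simp
    also have "\<dots> = 4 * K * v ^ 4" by (simp add: power_mult_distrib flip: power_mult)
    also have "\<dots> \<le> exp v" using elim assms by (simp add: field_simps)
    finally show ?case .
  qed
  from eventually_compose_filterlim[OF this sqrt_at_top]
  have "\<forall>\<^sub>F u in at_top. K * ((sqrt u)\<^sup>2 + 3)\<^sup>2 \<le> exp (sqrt u)" .
  then show ?thesis
    using eventually_ge_at_top[of 0] by eventually_elim simp
qed

lemma erdos_gyarfas_le_exp:
  fixes y u :: real
  assumes "3 \<le> r" and y: "real n = exp y" and u: "y = exp u" "0 \<le> u"
  shows "real (erdos_gyarfas r n (r + 1) r)
    \<le> exp (1600 * real r ^ 3 * (u + 3)\<^sup>2 * y powr (2 / 5))"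
proof -
  \<comment> \<open>\<open>j\<close> is least with \<open>2 * y \<le> 32 ^ j\<close>; as
    \<open>y / ln 2 \<le> 2 * y\<close>, this ensures \<open>n \<le> 2 ^ (32 ^ j)\<close>.\<close>
  define L where "L = log 2 (2 * y)"
  define j where "j = nat \<lceil>L / 5\<rceil>"
  have y1: "1 \<le> y" using u by simp
  have L: "0 \<le> L" "2 powr L = 2 * y" using y1 by (simp_all add: L_def)
  have j: "L / 5 \<le> j" "j \<le> L / 5 + 1" using L(1) by (simp_all add: j_def)
  have ln2: "1 / 2 \<le> ln (2::real)"
    by (subst ln_ge_iff) (use exp_bound_half[of "1 / 2 :: real"] in simp_all)
  define v where "v = u / ln 2"
  have "L = 1 + v" using u y1 by (simp add: L_def v_def log_def ln_mult add_divide_distrib)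
  moreover have "v \<le> u / (1 / 2)"
    unfolding v_def using ln2 u(2) by (intro divide_left_mono) auto
  then have "v \<le> u * 2" by simp
  ultimately have ju: "real j + 1 \<le> u + 3" using j(2) u(2) by linarith
  have "real n = 2 powr (y / ln 2)" by (simp add: y powr_def)
  also have "y / ln 2 \<le> y / (1 / 2)" using ln2 y1 by (intro divide_left_mono) auto
  then have "2 powr (y / ln 2) \<le> (2::real) powr (2 powr L)" using L(2) by simp
  also have "\<dots> \<le> 2 powr (2 powr (5 * real j))" using j(1) by simp
  also have "2 powr (5 * real j) = real (32 ^ j)"
    by (simp add: powr_powr[symmetric] powr_realpow)
  also have "2 powr real (32 ^ j) = real (2 ^ (32 ^ j))" by (subst powr_realpow) simp_all
  finally have "n \<le> 2 ^ (32 ^ j)" by (simp only: of_nat_le_iff)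
  note erdos_gyarfas_le_power2[OF assms(1) this]
  then have "real (erdos_gyarfas r n (r + 1) r) \<le> real (2 ^ (200 * r ^ 3 * (j + 1)\<^sup>2 * 4 ^ j))"
    by (simp only: of_nat_le_iff)
  also have "\<dots> = 2 ^ (200 * r ^ 3 * (j + 1)\<^sup>2 * 4 ^ j)" by simp
  also have "\<dots> \<le> exp 1 ^ (200 * r ^ 3 * (j + 1)\<^sup>2 * 4 ^ j)"
    using exp_ge_add_one_self[of 1] by (intro power_mono) auto
  also have "\<dots> = exp (200 * real r ^ 3 * (real j + 1)\<^sup>2 * 4 ^ j)"
    by (simp flip: exp_of_nat_mult add: add.commute)
  also have "\<dots> \<le> exp (200 * real r ^ 3 * (u + 3)\<^sup>2 * (8 * y powr (2 / 5)))"
  proof -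
    have "(4::real) ^ j = 2 powr (2 * real j)" by (simp add: powr_powr[symmetric] powr_realpow)
    \<comment> \<open>Rounding \<open>j\<close> up costs a factor 4 and the 2 in
      \<open>2 * y\<close> at most another 2, whence the 8.\<close>
    also have "\<dots> \<le> 2 powr (L * (2 / 5) + 2)" using j(2) by simp
    also have "\<dots> = 4 * (2 * y) powr (2 / 5)"
      unfolding powr_add powr_powr[symmetric] L(2) by simp
    also have "\<dots> = 4 * 2 powr (2 / 5) * y powr (2 / 5)" using y1 by (simp add: powr_mult)
    also have "\<dots> \<le> 4 * 2 powr 1 * y powr (2 / 5)"
      by (intro mult_right_mono mult_left_mono powr_mono) auto
    finally have "4 ^ j \<le> 8 * y powr (2 / 5)" by simp
    then show ?thesis unfolding exp_le_cancel_iff using ju u(2) by (intro mult_mono power_mono) auto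
  qed
  finally show ?thesis by (simp add: mult_ac)
qed

theorem theorem1p16:
  fixes r :: nat
  assumes "r \<ge> 3"
  shows "\<exists>\<epsilon> :: nat \<Rightarrow> real. \<epsilon> \<longlonglongrightarrow> 0 \<and>
           (\<forall>\<^sub>F n in sequentially.
              real (erdos_gyarfas r n (r + 1) r) \<le> exp (ln (real n) powr (2 / 5 + \<epsilon> n))) \<and>
           (\<exists>\<delta> :: nat \<Rightarrow> real. \<delta> \<longlonglongrightarrow> 0 \<and>
              (\<forall>\<^sub>F n in sequentially.
                 exp (ln (real n) powr (2 / 5 + \<epsilon> n)) = real n powr \<delta> n))"
proof -
  define y where "y n = ln (real n)" for n
  define u where "u n = ln (y n)" for n
  \<comment> \<open>Chosen so that \<open>y n powr \<epsilon> n = exp (sqrt (u n))\<close>, which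
    outgrows \<open>(u n + 3)\<^sup>2\<close> although \<open>\<epsilon>\<close> tends to 0.\<close>
  define \<epsilon> where "\<epsilon> n = 1 / sqrt (u n)" for n
  \<comment> \<open>The solution of
    \<open>\<delta> n * y n = y n powr (2 / 5 + \<epsilon> n)\<close>, that is, the exponent of
    \<open>n\<close> itself.\<close>
  define \<delta> where "\<delta> n = y n powr (2 / 5 + \<epsilon> n - 1)" for n
  have y_top: "filterlim y at_top sequentially"
    unfolding y_def by (rule filterlim_compose[OF ln_at_top filterlim_real_sequentially])
  have u_top: "filterlim u at_top sequentially"
    unfolding u_def by (rule filterlim_compose[OF ln_at_top y_top])
  have \<epsilon>: "\<epsilon> \<longlonglongrightarrow> 0"
    unfolding \<epsilon>_def
    by (intro tendsto_divide_0[OF tendsto_const] filterlim_at_top_imp_at_infinity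
        filterlim_compose[OF sqrt_at_top u_top])
  have u1: "\<forall>\<^sub>F n in sequentially. 1 \<le> u n"
    using u_top by (simp add: filterlim_at_top)
  have y1: "\<forall>\<^sub>F n in sequentially. 1 \<le> y n"
    using y_top by (simp add: filterlim_at_top)
  have n1: "\<forall>\<^sub>F n in sequentially. 1 \<le> n" by (rule eventually_ge_at_top)
  have "0 < 1600 * real r ^ 3" using assms by simp
  from eventually_compose_filterlim[OF eventually_square_le_exp_sqrt[OF this] u_top]
  have "\<forall>\<^sub>F n in sequentially.
      real (erdos_gyarfas r n (r + 1) r) \<le> exp (ln (real n) powr (2 / 5 + \<epsilon> n))"
    using u1 y1 n1
  proof eventually_elim
    case (elim n)
    have "real (erdos_gyarfas r n (r + 1) r)
        \<le> exp (1600 * real r ^ 3 * (u n + 3)\<^sup>2 * y n powr (2 / 5))"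
    proof (rule erdos_gyarfas_le_exp[OF assms])
      show "real n = exp (y n)" using elim(4) by (simp add: y_def)
      show "y n = exp (u n)" using elim(3) by (simp add: u_def)
      show "0 \<le> u n" using elim(2) by simp
    qed
    also have "\<dots> \<le> exp (exp (sqrt (u n)) * y n powr (2 / 5))"
      using elim(1) by (simp add: mult_right_mono)
    also have "exp (sqrt (u n)) = y n powr \<epsilon> n"
    proof -
      have "\<epsilon> n * u n = sqrt (u n)" using elim(2) by (simp add: \<epsilon>_def real_div_sqrt)
      then show ?thesis using elim(3) by (simp add: powr_def u_def)
    qed
    also have "\<dots> * y n powr (2 / 5) = y n powr (2 / 5 + \<epsilon> n)"
      by (simp add: powr_add)
    finally show ?case by (simp add: y_def)
  qed
  moreover have "\<delta> \<longlonglongrightarrow> 0"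
  proof (rule tendsto_sandwich[OF _ _ tendsto_const])
    show "(\<lambda>n. y n powr (- (1 / 5))) \<longlonglongrightarrow> 0"
      by (rule tendsto_neg_powr[OF _ y_top]) simp
    have "\<forall>\<^sub>F n in sequentially. \<epsilon> n < 2 / 5"
      using \<epsilon> by (rule order_tendstoD) simp
    with y1 show "\<forall>\<^sub>F n in sequentially. \<delta> n \<le> y n powr (- (1 / 5))"
      by eventually_elim (auto simp: \<delta>_def intro!: powr_mono)
  qed (simp add: \<delta>_def)
  moreover have "\<forall>\<^sub>F n in sequentially.
      exp (ln (real n) powr (2 / 5 + \<epsilon> n)) = real n powr \<delta> n"
    using y1 n1
  proof eventually_elim
    case (elim n)
    have "\<delta> n * y n powr 1 = y n powr (2 / 5 + \<epsilon> n)"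
      unfolding \<delta>_def powr_add[symmetric] by simp
    then have "\<delta> n * y n = y n powr (2 / 5 + \<epsilon> n)" using elim(1) by simp
    then show ?case using elim(2) by (simp add: powr_def[of "real n"] y_def)
  qed
  ultimately show ?thesis using \<epsilon> by blast
qed

end
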